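(* Let $(X_t,Y_t)_{t\in\mathbb{N}}$ be the natural coupling of two Elo processes, starting from any random vectors $X_0,Y_0\in\mathcal{Z}_N$. Then $\|X_t-Y_t\|$ is almost surely non-increasing in $t$, and $$\lim_{t\to\infty}\|X_t-Y_t\|=0\quad\text{almost surely.}$$
   Context: Notation: $\mathbb{N}=\{0,1,2,\dots\}$; $N\ge 2$ is an integer (number of players); $\|\cdot\|$ is the Euclidean norm on $\mathbb{R}^N$; $x^i$ is the $i$-th coordinate of $x$; $e_i$ is the $i$-th canonical vector; $\mathcal{Z}_N=\{x\in\mathbb{R}^N:\sum_{i=1}^N x^i=0\}$. Standing assumptions. (i) $\rho=(\rho^1,\dots,\rho^N)\in\mathcal{Z}_N$ is a fixed vector (true skills). (ii) $b:\mathbb{R}\to(-1,1)$ is odd, strictly increasing and $L$-Lipschitz, and for every $M>0$, $\ell_M:=\inf_{-M\le v<u\le M}\frac{b(u)-b(v)}{u-v}>0$. (iii) For every distinct $i,j\in\{1,\dots,N\}$, $S^{ij}$ is a random variable with values in $[-1,1]$, $\mathbb{E}[S^{ij}]=b(\rho^i-\rho^j)$ and $S^{ji}=-S^{ij}$. (iv) $K>0$ is a constant with $KL<1$. (v) For every distinct $i,j$ and every $\epsilon>0$, $\mathbb{P}(S^{ij}<-1+\epsilon)>0$ and $\mathbb{P}(S^{ij}>1-\epsilon)>0$. Elo process: the Markov chain $(X_t)_{t\in\mathbb{N}}$ on $\mathcal{Z}_N$ started from a random vector $X_0\in\mathcal{Z}_N$ with the following dynamics: at step $t$, an ordered pair $(I_t,J_t)$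 of distinct indices in $\{1,\dots,N\}$ is chosen uniformly at random (independently of the past); given $I_t=i,J_t=j$, an independent copy $S_t^{ij}$ of $S^{ij}$ is sampled; and $X_{t+1}=X_t+K\{S_t^{ij}-b(X_t^i-X_t^j)\}(e_i-e_j)$. Natural coupling: given arbitrary random initial conditions $X_0,Y_0\in\mathcal{Z}_N$ (on a common probability space), $(X_t,Y_t)_{t\in\mathbb{N}}$ is obtained by running both Elo processes with exactly the same randomness: at each step $t$ both use the same pair $i=I_t,j=J_t$ and the same realization of $S_t^{ij}$. *)

theory Defs
  imports "HOL-Probability.Probability"
begin

definition zero_sum :: "(real ^ 'n) set" where
  "zero_sum = {x. (\<Sum>i\<in>UNIV. x $ i) = 0}"

definition min_slope :: "(real \<Rightarrow> real) \<Rightarrow> real \<Rightarrow> real" where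
  "min_slope b m = (INF (u, v) \<in> {(u, v). - m \<le> v \<and> v < u \<and> u \<le> m}. (b u - b v) / (u - v))"

text \<open>Players are the elements of the finite type \<open>'n\<close>. The scores \<open>S i j\<close> are random variables
  on a reference probability space \<open>W\<close>, used only through the law of each one; \<open>S i i\<close> is
  unconstrained. The space \<open>W\<close> is unrelated to the space on which the Elo processes live.\<close>

locale elo_model = prob_space W
  for W :: "'w measure" +
  fixes \<rho> :: "real ^ 'n"
    and b :: "real \<Rightarrow> real"
    and L K :: real
    and S :: "'n \<Rightarrow> 'n \<Rightarrow> 'w \<Rightarrow> real"
  assumes players: "CARD('n) \<ge> 2"
    and skills: "\<rho> \<in> zero_sum"
    and b_range: "range b \<subseteq> {-1<..<1}"
    and b_odd: "\<And>x. b (- x) = - b x"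
    and b_strict_mono: "strict_mono b"
    and b_lipschitz: "L-lipschitz_on UNIV b"
    and b_slope: "\<And>m. m > 0 \<Longrightarrow> min_slope b m > 0"
    and score_measurable: "\<And>i j. i \<noteq> j \<Longrightarrow> S i j \<in> borel_measurable W"
    and score_range: "\<And>i j w. i \<noteq> j \<Longrightarrow> w \<in> space W \<Longrightarrow> S i j w \<in> {-1..1}"
    and score_mean: "\<And>i j. i \<noteq> j \<Longrightarrow> expectation (S i j) = b (\<rho> $ i - \<rho> $ j)"
    and score_antisym: "\<And>i j w. i \<noteq> j \<Longrightarrow> w \<in> space W \<Longrightarrow> S j i w = - S i j w"
    and K_pos: "K > 0"
    and KL: "K * L < 1"
    and score_near_minus_one:
      "\<And>i j \<epsilon>. i \<noteq> j \<Longrightarrow> \<epsilon> > 0 \<Longrightarrow> \<P>(w in W. S i j w < - 1 + \<epsilon>) > 0"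
    and score_near_one:
      "\<And>i j \<epsilon>. i \<noteq> j \<Longrightarrow> \<epsilon> > 0 \<Longrightarrow> \<P>(w in W. S i j w > 1 - \<epsilon>) > 0"

definition elo_step ::
  "(real \<Rightarrow> real) \<Rightarrow> real \<Rightarrow> 'n \<Rightarrow> 'n \<Rightarrow> real \<Rightarrow> real ^ 'n \<Rightarrow> real ^ 'n" where
  "elo_step b K i j s x = x + (K * (s - b (x $ i - x $ j))) *\<^sub>R (axis i 1 - axis j 1)"

abbreviation round_space :: "('n \<times> 'n \<times> real) measure" where
  "round_space \<equiv> count_space UNIV \<Otimes>\<^sub>M count_space UNIV \<Otimes>\<^sub>M borel"

text \<open>Round \<open>t\<close> consists of the pair \<open>(I t, J t)\<close> and the realised score \<open>Z t\<close>, i.e. the sampled copy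
  of \<open>S i j\<close> for the chosen pair \<open>(i, j)\<close>. The past before round \<open>t\<close> is generated by the initial
  data \<open>U\<close> and the rounds \<open>s < t\<close>; the whole round \<open>t\<close> is independent of it, so the score is an
  independent copy both of the past rounds and of the initial data.\<close>

definition elo_rounds ::
  "'a measure \<Rightarrow> 'w measure \<Rightarrow> ('n::finite \<Rightarrow> 'n \<Rightarrow> 'w \<Rightarrow> real) \<Rightarrow> ('a \<Rightarrow> 'u::topological_space) \<Rightarrow>
    (nat \<Rightarrow> 'a \<Rightarrow> 'n) \<Rightarrow> (nat \<Rightarrow> 'a \<Rightarrow> 'n) \<Rightarrow> (nat \<Rightarrow> 'a \<Rightarrow> real) \<Rightarrow> bool" where
  "elo_rounds M W S U I J Z \<longleftrightarrow>
    prob_space M \<and>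
    U \<in> borel_measurable M \<and>
    (\<forall>t. (\<lambda>\<omega>. (I t \<omega>, J t \<omega>, Z t \<omega>)) \<in> M \<rightarrow>\<^sub>M round_space) \<and>
    (\<forall>t. distr M (count_space UNIV) (\<lambda>\<omega>. (I t \<omega>, J t \<omega>)) =
           uniform_measure (count_space UNIV) {(i, j). i \<noteq> j}) \<and>
    (\<forall>t i j. i \<noteq> j \<longrightarrow> (\<forall>A\<in>sets borel.
           \<P>(\<omega> in M. Z t \<omega> \<in> A \<bar> I t \<omega> = i \<and> J t \<omega> = j) = \<P>(w in W. S i j w \<in> A))) \<and>
    (\<forall>t. prob_space.indep_set M
           (sets (vimage_algebra (space M)
              (\<lambda>\<omega>. (U \<omega>, \<lambda>s\<in>{..<t}. (I s \<omega>, J s \<omega>, Z s \<omega>)))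
              (borel \<Otimes>\<^sub>M (\<Pi>\<^sub>M s\<in>{..<t}. round_space))))
           (sets (vimage_algebra (space M) (\<lambda>\<omega>. (I t \<omega>, J t \<omega>, Z t \<omega>)) round_space)))"

definition elo_process ::
  "'a measure \<Rightarrow> 'w measure \<Rightarrow> (real \<Rightarrow> real) \<Rightarrow> real \<Rightarrow> ('n::finite \<Rightarrow> 'n \<Rightarrow> 'w \<Rightarrow> real) \<Rightarrow>
    (nat \<Rightarrow> 'a \<Rightarrow> 'n) \<Rightarrow> (nat \<Rightarrow> 'a \<Rightarrow> 'n) \<Rightarrow> (nat \<Rightarrow> 'a \<Rightarrow> real) \<Rightarrow>
    (nat \<Rightarrow> 'a \<Rightarrow> real ^ 'n) \<Rightarrow> bool" where
  "elo_process M W b K S I J Z X \<longleftrightarrow>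
    elo_rounds M W S (X 0) I J Z \<and>
    (\<forall>\<omega>\<in>space M. X 0 \<omega> \<in> zero_sum \<and>
       (\<forall>t. X (Suc t) \<omega> = elo_step b K (I t \<omega>) (J t \<omega>) (Z t \<omega>) (X t \<omega>)))"

text \<open>Both processes use the same rounds, and these are independent of the initial states jointly,
  which is more than independence of each initial state separately.\<close>

definition natural_coupling ::
  "'a measure \<Rightarrow> 'w measure \<Rightarrow> (real \<Rightarrow> real) \<Rightarrow> real \<Rightarrow> ('n::finite \<Rightarrow> 'n \<Rightarrow> 'w \<Rightarrow> real) \<Rightarrow>
    (nat \<Rightarrow> 'a \<Rightarrow> 'n) \<Rightarrow> (nat \<Rightarrow> 'a \<Rightarrow> 'n) \<Rightarrow> (nat \<Rightarrow> 'a \<Rightarrow> real) \<Rightarrow>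
    (nat \<Rightarrow> 'a \<Rightarrow> real ^ 'n) \<Rightarrow> (nat \<Rightarrow> 'a \<Rightarrow> real ^ 'n) \<Rightarrow> bool" where
  "natural_coupling M W b K S I J Z X Y \<longleftrightarrow>
    elo_rounds M W S (\<lambda>\<omega>. (X 0 \<omega>, Y 0 \<omega>)) I J Z \<and>
    elo_process M W b K S I J Z X \<and>
    elo_process M W b K S I J Z Y"

end

theory Submission
  imports Defs
begin

text \<open>One nonnegative quantity controls everything: for states \<open>x\<close> and \<open>y\<close>, the
  \<^emph>\<open>dissipation\<close> is the sum over all pairs of players of
  \<open>(b (x\<^sup>i - x\<^sup>j) - b (y\<^sup>i - y\<^sup>j)) * ((x\<^sup>i - x\<^sup>j) - (y\<^sup>i - y\<^sup>j))\<close>. It is used twice, with the two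
  coupled states and with one state and the true skills \<open>\<rho>\<close>.

  Coupled states. In a round both states receive the same score, which cancels from the difference,
  so that \<open>\<parallel>X - Y\<parallel>\<^sup>2\<close> decreases by at least \<open>2 K (1 - K L)\<close> times the term of the chosen pair
  (\<open>elo_step_contracts\<close>). This holds surely and gives the monotonicity. The pair is independent of
  the past, so in expectation the decrease is at least a constant times the dissipation of \<open>X\<close>
  and \<open>Y\<close>. The total decrease is bounded by the initial value; hence the expected dissipations are
  summable and the dissipation tends to \<open>0\<close> almost surely
  (\<open>AE_coupled_dissipation_tendsto_0\<close>).

  This alone does not force \<open>X - Y\<close> to \<open>0\<close>, because \<open>b\<close> may flatten out and the dissipation be small
  when the states are far away. On a ball, however, the dissipation is at least a constant times
  \<open>\<parallel>X - Y\<parallel>\<^sup>2\<close>, so it suffices that \<open>X\<close> returns to some ball infinitely often.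

  Recurrence. In a round \<open>\<parallel>X - \<rho>\<parallel>\<^sup>2\<close> grows by no more than the sum of a negative multiple of the
  pair term of \<open>X\<close> and \<open>\<rho>\<close>, a noise term whose expectation vanishes since the score has mean
  \<open>b (\<rho>\<^sup>i - \<rho>\<^sup>j)\<close>, and a constant (\<open>elo_step_drift\<close>). Hence the time averages of the expected dissipation of \<open>X\<close> and \<open>\<rho>\<close>
  stay bounded, and by Fatou's lemma this dissipation almost surely does not tend to infinity
  (\<open>AE_dissipation_not_at_top\<close>). As it grows at least linearly in \<open>\<parallel>X - \<rho>\<parallel>\<close>
  (\<open>dissipation_coercive\<close>), \<open>X\<close> returns to some random ball infinitely often, and \<open>Y\<close> is
  never farther from \<open>X\<close> than at the start (\<open>distance_tendsto_0_if_recurrent\<close>).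

  The initial states need not be integrable. All expectations are therefore taken on the event that
  both start in a ball of radius \<open>n\<close>, where every quantity is bounded at each fixed time; the events
  exhaust the space as \<open>n\<close> grows.\<close>

section \<open>Almost sure behaviour of processes with controlled expectations\<close>

lemma AE_tendsto_0_if_summable_expectations:
  fixes f :: "nat \<Rightarrow> 'a \<Rightarrow> real" and C :: real
  assumes int: "\<And>t. integrable M (f t)"
    and nonneg: "\<And>t \<omega>. 0 \<le> f t \<omega>"
    and bound: "\<And>T. (\<Sum>t<T. integral\<^sup>L M (f t)) \<le> C"
  shows "AE \<omega> in M. (\<lambda>t. f t \<omega>) \<longlonglongrightarrow> 0"
proof -
  have [measurable]: "f t \<in> borel_measurable M" for t
    using int by auto
  have "(\<integral>\<^sup>+\<omega>. (\<Sum>t. ennreal (f t \<omega>)) \<partial>M) = (\<Sum>t. ennreal (integral\<^sup>L M (f t)))"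
    by (simp add: nn_integral_suminf nn_integral_eq_integral int nonneg)
  also have "\<dots> \<le> ennreal C"
  proof (rule suminf_le_const)
    fix T
    show "(\<Sum>t<T. ennreal (integral\<^sup>L M (f t))) \<le> ennreal C"
      by (simp add: sum_ennreal nonneg bound ennreal_leI)
  qed auto
  finally have "AE \<omega> in M. (\<Sum>t. ennreal (f t \<omega>)) \<noteq> \<infinity>"
    by (intro nn_integral_PInf_AE) (auto simp: top_unique)
  then show ?thesis
    by eventually_elim (auto intro!: summable_LIMSEQ_zero summable_suminf_not_top nonneg)
qed

lemma average_at_top:
  fixes f :: "nat \<Rightarrow> real"
  assumes nonneg: "\<And>t. 0 \<le> f t" and lim: "filterlim f at_top sequentially"
  shows "filterlim (\<lambda>T. (\<Sum>t<Suc T. f t) / Suc T) at_top sequentially"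
  unfolding filterlim_at_top
proof
  fix m :: real
  obtain s where s: "\<And>t. t \<ge> s \<Longrightarrow> f t \<ge> 2 * \<bar>m\<bar>"
    using lim unfolding filterlim_at_top eventually_sequentially by metis
  show "\<forall>\<^sub>F T in sequentially. m \<le> (\<Sum>t<Suc T. f t) / Suc T"
    unfolding eventually_sequentially
  proof (intro exI allI impI)
    fix T assume T: "2 * s \<le> T"
    \<comment> \<open>At least half of the first \<open>Suc T\<close> terms come after time \<open>s\<close>.\<close>
    have "m * Suc T \<le> \<bar>m\<bar> * Suc T"
      by (intro mult_right_mono) auto
    also have "\<dots> \<le> (\<Sum>t=s..<Suc T. 2 * \<bar>m\<bar>)"
    proof -
      have "real (Suc T) \<le> 2 * real (Suc T - s)" using T by simp
      then have "\<bar>m\<bar> * real (Suc T) \<le> \<bar>m\<bar> * (2 * real (Suc T - s))"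
        by (intro mult_left_mono) auto
      then show ?thesis by (simp add: algebra_simps)
    qed
    also have "\<dots> \<le> (\<Sum>t=s..<Suc T. f t)"
      by (intro sum_mono s) auto
    also have "\<dots> \<le> (\<Sum>t<Suc T. f t)"
      by (intro sum_mono2 nonneg) auto
    finally show "m \<le> (\<Sum>t<Suc T. f t) / Suc T"
      by (simp add: field_simps)
  qed
qed

text \<open>Along a path that tends to infinity the time averages would tend to infinity as well; by Fatou's
  lemma, averages with bounded expectations do so only with probability \<open>0\<close>.\<close>

lemma AE_not_at_top_if_linear_expectations:
  fixes f :: "nat \<Rightarrow> 'a \<Rightarrow> real" and C :: real
  assumes int: "\<And>t. integrable M (f t)"
    and nonneg: "\<And>t \<omega>. 0 \<le> f t \<omega>"
    and bound: "\<And>T. (\<Sum>t<Suc T. integral\<^sup>L M (f t)) \<le> C * Suc T"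
  shows "AE \<omega> in M. \<not> filterlim (\<lambda>t. f t \<omega>) at_top sequentially"
proof -
  define u where "u T \<omega> = (\<Sum>t<Suc T. f t \<omega>) / Suc T" for T \<omega>
  have int_u: "integrable M (u T)" for T
    unfolding u_def by (intro integrable_divide Bochner_Integration.integrable_sum int)
  have [measurable]: "u T \<in> borel_measurable M" for T
    using int_u by auto
  have u_nonneg: "0 \<le> u T \<omega>" for T \<omega>
    unfolding u_def by (intro divide_nonneg_nonneg sum_nonneg nonneg) auto
  have le: "integral\<^sup>L M (u T) \<le> C" for T
  proof -
    have "integral\<^sup>L M (u T) = (\<Sum>t<Suc T. integral\<^sup>L M (f t)) / Suc T"
      unfolding u_def by (simp only: integral_divide Bochner_Integration.integral_sum int integral_divide_zero)
    then show ?thesis using bound[of T] by (simp add: divide_le_eq)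
  qed
  have "(\<integral>\<^sup>+\<omega>. liminf (\<lambda>T. ennreal (u T \<omega>)) \<partial>M) \<le> liminf (\<lambda>T. \<integral>\<^sup>+\<omega>. ennreal (u T \<omega>) \<partial>M)"
    by (rule nn_integral_liminf) simp
  also have "\<dots> \<le> ennreal C"
    by (intro Liminf_le always_eventually allI)
      (simp_all add: nn_integral_eq_integral int_u u_nonneg le ennreal_leI)
  finally have "AE \<omega> in M. liminf (\<lambda>T. ennreal (u T \<omega>)) \<noteq> \<infinity>"
    by (intro nn_integral_PInf_AE) (auto simp: top_unique)
  then show ?thesis
  proof eventually_elim
    fix \<omega> assume fin: "liminf (\<lambda>T. ennreal (u T \<omega>)) \<noteq> \<infinity>"
    show "\<not> filterlim (\<lambda>t. f t \<omega>) at_top sequentially"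
    proof
      assume "filterlim (\<lambda>t. f t \<omega>) at_top sequentially"
      then have "filterlim (\<lambda>T. u T \<omega>) at_top sequentially"
        unfolding u_def by (intro average_at_top nonneg)
      then have "(\<lambda>T. ennreal (u T \<omega>)) \<longlonglongrightarrow> \<infinity>"
        by (simp add: ennreal_tendsto_top_eq_at_top)
      with fin show False
        using lim_imp_Liminf sequentially_bot by blast
    qed
  qed
qed

section \<open>Geometry of rating vectors\<close>

definition pair_diss :: "(real \<Rightarrow> real) \<Rightarrow> real ^ 'n \<Rightarrow> real ^ 'n \<Rightarrow> 'n \<Rightarrow> 'n \<Rightarrow> real" where
  "pair_diss b x y i j =
     (b (x $ i - x $ j) - b (y $ i - y $ j)) * ((x $ i - x $ j) - (y $ i - y $ j))"

definition dissipation :: "(real \<Rightarrow> real) \<Rightarrow> real ^ 'n \<Rightarrow> real ^ 'n \<Rightarrow> real" where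
  "dissipation b x y = (\<Sum>i\<in>UNIV. \<Sum>j\<in>UNIV. pair_diss b x y i j)"

text \<open>Every Elo update has this shape: an amount \<open>c\<close> moves from player \<open>j\<close> to player \<open>i\<close>. The bound is an
  equality for \<open>i \<noteq> j\<close>, and \<open>i = j\<close> is covered because then nothing moves.\<close>

lemma norm_sq_transfer_le:
  fixes u :: "real ^ 'n"
  shows "(norm (u + c *\<^sub>R (axis i 1 - axis j 1)))\<^sup>2 \<le> (norm u)\<^sup>2 + 2 * c * (u $ i - u $ j) + 2 * c\<^sup>2"
proof -
  define a :: "real ^ 'n" where "a = axis i 1 - axis j 1"
  have "u \<bullet> a = u $ i - u $ j"
    unfolding a_def by (simp add: inner_axis inner_diff_right)
  moreover have "a \<bullet> a \<le> 2"
    unfolding a_def by (simp add: inner_axis_axis inner_diff_left inner_diff_right)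
  then have "c\<^sup>2 * (a \<bullet> a) \<le> c\<^sup>2 * 2"
    by (intro mult_left_mono) auto
  moreover have "(norm (u + c *\<^sub>R a))\<^sup>2 = (norm u)\<^sup>2 + 2 * c * (u \<bullet> a) + c\<^sup>2 * (a \<bullet> a)"
    unfolding power2_norm_eq_inner
    by (simp add: inner_add_left inner_add_right inner_commute[of a u] power2_eq_square algebra_simps)
  ultimately show ?thesis
    unfolding a_def by simp
qed

text \<open>For zero-sum vectors the coordinate differences determine the norm: expanding the squares, the mixed
  terms add up to the square of the coordinate sum.\<close>

lemma sum_sq_differences:
  fixes d :: "real ^ 'n"
  assumes "d \<in> zero_sum"
  shows "(\<Sum>i\<in>UNIV. \<Sum>j\<in>UNIV. (d $ i - d $ j)\<^sup>2) = 2 * CARD('n) * (norm d)\<^sup>2"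
proof -
  have n: "(norm d)\<^sup>2 = (\<Sum>i\<in>UNIV. (d $ i)\<^sup>2)"
    by (simp add: norm_vec_def L2_set_def sum_nonneg)
  have "(\<Sum>i\<in>UNIV. \<Sum>j\<in>UNIV. (d $ i - d $ j)\<^sup>2)
      = (\<Sum>i\<in>UNIV. \<Sum>j\<in>UNIV. (d $ i)\<^sup>2 + (d $ j)\<^sup>2 - 2 * (d $ i * d $ j))"
    by (simp add: power2_diff mult.assoc)
  also have "\<dots> = 2 * CARD('n) * (\<Sum>i\<in>UNIV. (d $ i)\<^sup>2) - 2 * (\<Sum>i\<in>UNIV. d $ i)\<^sup>2"
    by (simp add: sum.distrib sum_subtractf power2_eq_square sum_product flip: sum_distrib_left)
  finally show ?thesis
    using assms n by (simp add: zero_sum_def)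
qed

text \<open>The differences \<open>u\<^sup>i - u\<^sup>j\<close> with \<open>i\<close> fixed sum to the number of players times \<open>u\<^sup>i\<close>.\<close>

lemma norm_le_sum_abs_differences:
  fixes u :: "real ^ 'n"
  assumes "u \<in> zero_sum"
  shows "norm u \<le> (\<Sum>i\<in>UNIV. \<Sum>j\<in>UNIV. \<bar>u $ i - u $ j\<bar>)"
proof -
  have "norm u \<le> (\<Sum>i\<in>UNIV. \<bar>u $ i\<bar>)" by (rule norm_le_l1_cart)
  also have "\<dots> \<le> (\<Sum>i\<in>UNIV. \<bar>\<Sum>j\<in>UNIV. u $ i - u $ j\<bar>)"
  proof (rule sum_mono)
    fix i
    have "(\<Sum>j\<in>UNIV. u $ i - u $ j) = CARD('n) * u $ i"
      using assms by (simp add: sum_subtractf zero_sum_def)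
    moreover have "1 * \<bar>u $ i\<bar> \<le> real CARD('n) * \<bar>u $ i\<bar>"
      by (intro mult_right_mono) (simp_all add: Suc_leI)
    ultimately show "\<bar>u $ i\<bar> \<le> \<bar>\<Sum>j\<in>UNIV. u $ i - u $ j\<bar>"
      by (simp add: abs_mult)
  qed
  also have "\<dots> \<le> (\<Sum>i\<in>UNIV. \<Sum>j\<in>UNIV. \<bar>u $ i - u $ j\<bar>)"
    by (intro sum_mono sum_abs)
  finally show ?thesis .
qed

lemma zero_sum_diff: "x \<in> zero_sum \<Longrightarrow> y \<in> zero_sum \<Longrightarrow> x - y \<in> zero_sum"
  by (simp add: zero_sum_def sum_subtractf)

lemma elo_step_zero_sum:
  fixes x :: "real ^ 'n"
  assumes "x \<in> zero_sum"
  shows "elo_step b K i j s x \<in> zero_sum"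
proof -
  have "(\<Sum>k\<in>UNIV. (axis l 1 :: real ^ 'n) $ k) = 1" for l
    by (simp add: axis_def)
  then show ?thesis
    using assms
    by (simp add: zero_sum_def elo_step_def sum.distrib sum_subtractf flip: sum_distrib_left)
qed

section \<open>One round of the Elo dynamics\<close>

context elo_model
begin

lemma b_bounded: "\<bar>b v\<bar> \<le> 1"
  using subsetD[OF b_range rangeI[of b v]] by auto

lemma continuous_on_b: "continuous_on UNIV b"
  using b_lipschitz by (rule lipschitz_on_continuous_on)

lemma b_measurable [measurable]: "b \<in> borel_measurable borel"
  using continuous_on_b by (rule borel_measurable_continuous_onI)

lemma increment_nonneg: "0 \<le> (b u - b v) * (u - v)"
  using b_strict_mono strict_mono_less_eq[of b u v] strict_mono_less_eq[of b v u]
  by (cases "u \<le> v") (auto simp: mult_nonneg_nonneg mult_nonpos_nonpos)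

text \<open>A Lipschitz monotone function is cocoercive. This is what lets the quadratic part of an update be
  absorbed by its linear part as long as \<open>K * L < 1\<close>.\<close>

lemma increment_sq_le: "(b u - b v)\<^sup>2 \<le> L * ((b u - b v) * (u - v))"
proof -
  have "\<bar>b u - b v\<bar> \<le> L * \<bar>u - v\<bar>"
    using lipschitz_on_normD[OF b_lipschitz, of u v] by simp
  then have "\<bar>b u - b v\<bar> * \<bar>b u - b v\<bar> \<le> \<bar>b u - b v\<bar> * (L * \<bar>u - v\<bar>)"
    by (intro mult_left_mono) auto
  also have "\<dots> = L * ((b u - b v) * (u - v))"
    using increment_nonneg[of u v] by (simp flip: abs_mult)
  finally show ?thesis by (simp add: power2_eq_square)
qed

lemma increment_ge_slope:
  assumes "\<bar>u\<bar> \<le> m" "\<bar>v\<bar> \<le> m"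
  shows "min_slope b m * (u - v)\<^sup>2 \<le> (b u - b v) * (u - v)"
proof -
  have *: "min_slope b m * (u - v)\<^sup>2 \<le> (b u - b v) * (u - v)"
    if "v < u" "\<bar>u\<bar> \<le> m" "\<bar>v\<bar> \<le> m" for u v
  proof -
    have "min_slope b m \<le> (case (u, v) of (u, v) \<Rightarrow> (b u - b v) / (u - v))"
      unfolding min_slope_def
    proof (rule cINF_lower)
      show "bdd_below ((\<lambda>(u, v). (b u - b v) / (u - v)) ` {(u, v). - m \<le> v \<and> v < u \<and> u \<le> m})"
        using b_strict_mono
        by (intro bdd_belowI[of _ 0]) (auto simp: strict_mono_less less_imp_le intro!: divide_nonneg_pos)
    qed (use that in auto)
    then have "min_slope b m * (u - v) * (u - v) \<le> (b u - b v) * (u - v)"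
      using that(1) by (intro mult_right_mono) (auto simp: field_simps)
    then show ?thesis by (simp add: power2_eq_square mult.assoc)
  qed
  consider "v < u" | "u < v" | "u = v" by linarith
  then show ?thesis
  proof cases
    case 2
    then show ?thesis using *[of u v] assms
      by (simp add: power2_commute algebra_simps)
  qed (use * assms in auto)
qed

text \<open>Increments of \<open>b\<close> around a bounded point grow at least linearly, although the slope of \<open>b\<close> may vanish
  at infinity: by monotonicity, a step of length at least \<open>1\<close> gains as much as the unit step, whose end
  points stay in the range where the slope is bounded below. Subtracting \<open>1\<close> makes the bound trivial
  for shorter steps.\<close>

lemma increment_ge_linear:
  assumes "1 \<le> r" "\<bar>v\<bar> \<le> r - 1"
  shows "min_slope b r * (\<bar>u - v\<bar> - 1) \<le> (b u - b v) * (u - v)"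
proof -
  have l: "min_slope b r > 0" using b_slope[of r] assms by simp
  have step: "min_slope b r \<le> b (v + 1) - b v" "min_slope b r \<le> b v - b (v - 1)"
    using increment_ge_slope[of "v + 1" r v] increment_ge_slope[of v r "v - 1"] assms by auto
  consider "1 \<le> u - v" | "u - v \<le> - 1" | "\<bar>u - v\<bar> < 1" by linarith
  then show ?thesis
  proof cases
    case 1
    have "b (v + 1) \<le> b u"
      using 1 b_strict_mono by (simp add: strict_mono_less_eq)
    then have "min_slope b r * (u - v) \<le> (b u - b v) * (u - v)"
      using step 1 by (intro mult_right_mono) auto
    then show ?thesis using l 1 by (simp add: algebra_simps)
  next
    case 2
    have "b u \<le> b (v - 1)"
      using 2 b_strict_mono by (simp add: strict_mono_less_eq)
    then have "min_slope b r * (v - u) \<le> (b v - b u) * (v - u)"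
      using step 2 by (intro mult_right_mono) auto
    then show ?thesis using l 2 by (simp add: algebra_simps)
  next
    case 3
    then have "min_slope b r * (\<bar>u - v\<bar> - 1) \<le> 0"
      using l by (intro mult_nonneg_nonpos) auto
    then show ?thesis using increment_nonneg[of u v] by linarith
  qed
qed

lemma pair_diss_nonneg: "0 \<le> pair_diss b x y i j"
  unfolding pair_diss_def by (rule increment_nonneg)

lemma dissipation_nonneg: "0 \<le> dissipation b x y"
  unfolding dissipation_def by (intro sum_nonneg pair_diss_nonneg)

text \<open>The common score \<open>s\<close> cancels in the difference of the two updates.\<close>

lemma elo_step_contracts:
  "(norm (elo_step b K i j s x - elo_step b K i j s y))\<^sup>2
     \<le> (norm (x - y))\<^sup>2 - 2 * K * (1 - K * L) * pair_diss b x y i j"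
proof -
  define g where "g = b (x $ i - x $ j) - b (y $ i - y $ j)"
  have "elo_step b K i j s x - elo_step b K i j s y
      = (x - y) + (- K * g) *\<^sub>R (axis i 1 - axis j 1)"
    unfolding elo_step_def g_def by (simp add: algebra_simps)
  then have "(norm (elo_step b K i j s x - elo_step b K i j s y))\<^sup>2
      \<le> (norm (x - y))\<^sup>2 + 2 * (- K * g) * ((x - y) $ i - (x - y) $ j) + 2 * (- K * g)\<^sup>2"
    by (simp only: norm_sq_transfer_le)
  also have "2 * (- K * g) * ((x - y) $ i - (x - y) $ j) = - 2 * K * pair_diss b x y i j"
    unfolding pair_diss_def g_def by (simp add: algebra_simps)
  also have "2 * (- K * g)\<^sup>2 \<le> 2 * K\<^sup>2 * (L * pair_diss b x y i j)"
    unfolding pair_diss_def g_def using increment_sq_le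
    by (simp add: power_mult_distrib mult_left_mono)
  finally show ?thesis by (simp add: algebra_simps power2_eq_square)
qed

lemma elo_step_contracts_norm:
  "norm (elo_step b K i j s x - elo_step b K i j s y) \<le> norm (x - y)"
proof -
  have "0 \<le> 2 * K * (1 - K * L) * pair_diss b x y i j"
    using K_pos KL pair_diss_nonneg[of x y i j] by simp
  then have "(norm (elo_step b K i j s x - elo_step b K i j s y))\<^sup>2 \<le> (norm (x - y))\<^sup>2"
    using elo_step_contracts[of i j s x y] by linarith
  then show ?thesis by (rule power2_le_imp_le) simp
qed

text \<open>The surprise \<open>s - b (x\<^sup>i - x\<^sup>j)\<close> splits into the deviation of the score from its mean
  \<open>b (\<rho>\<^sup>i - \<rho>\<^sup>j)\<close>, which is noise, and a systematic error that pulls the ratings towards the skills.\<close>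

lemma elo_step_drift:
  assumes s: "\<bar>s\<bar> \<le> 1"
  shows "(norm (elo_step b K i j s x - \<rho>))\<^sup>2
     \<le> (norm (x - \<rho>))\<^sup>2 - 2 * K * pair_diss b x \<rho> i j
        + 2 * K * ((s - b (\<rho> $ i - \<rho> $ j)) * ((x $ i - x $ j) - (\<rho> $ i - \<rho> $ j))) + 8 * K\<^sup>2"
proof -
  define c where "c = s - b (x $ i - x $ j)"
  have "elo_step b K i j s x - \<rho> = (x - \<rho>) + (K * c) *\<^sub>R (axis i 1 - axis j 1)"
    unfolding elo_step_def c_def by simp
  then have "(norm (elo_step b K i j s x - \<rho>))\<^sup>2
      \<le> (norm (x - \<rho>))\<^sup>2 + 2 * (K * c) * ((x - \<rho>) $ i - (x - \<rho>) $ j) + 2 * (K * c)\<^sup>2"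
    by (simp only: norm_sq_transfer_le)
  moreover have "2 * (K * c) * ((x - \<rho>) $ i - (x - \<rho>) $ j) = - 2 * K * pair_diss b x \<rho> i j
        + 2 * K * ((s - b (\<rho> $ i - \<rho> $ j)) * ((x $ i - x $ j) - (\<rho> $ i - \<rho> $ j)))"
    unfolding pair_diss_def c_def by (simp add: algebra_simps)
  moreover have "2 * (K * c)\<^sup>2 \<le> 8 * K\<^sup>2"
  proof -
    have "\<bar>c\<bar> \<le> 2" unfolding c_def using s b_bounded[of "x $ i - x $ j"] by linarith
    then have "c\<^sup>2 \<le> 2\<^sup>2" by (intro abs_le_square_iff[THEN iffD1]) auto
    then have "2 * K\<^sup>2 * c\<^sup>2 \<le> 2 * K\<^sup>2 * 4" by (intro mult_left_mono) auto
    then show ?thesis by (simp add: power_mult_distrib mult_ac)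
  qed
  ultimately show ?thesis by linarith
qed

lemma norm_elo_step_le:
  fixes x :: "real ^ 'n"
  assumes s: "\<bar>s\<bar> \<le> 1"
  shows "norm (elo_step b K i j s x) \<le> norm x + 4 * K"
proof -
  have "\<bar>s - b (x $ i - x $ j)\<bar> \<le> 2"
    using s b_bounded[of "x $ i - x $ j"] by linarith
  then have "K * \<bar>s - b (x $ i - x $ j)\<bar> * norm (axis i 1 - axis j 1 :: real ^ 'n) \<le> K * 2 * 2"
    using K_pos norm_triangle_ineq4[of "axis i 1 :: real ^ 'n" "axis j 1"]
    by (intro mult_mono mult_left_mono) auto
  then show ?thesis
    unfolding elo_step_def using K_pos
    by (intro norm_triangle_le) (simp add: abs_mult)
qed

lemma dissipation_ge_norm_sq:
  fixes x y :: "real ^ 'n"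
  assumes "x - y \<in> zero_sum" "norm x \<le> m" "norm y \<le> m"
  shows "min_slope b (2 * m) * (2 * CARD('n) * (norm (x - y))\<^sup>2) \<le> dissipation b x y"
proof -
  have "min_slope b (2 * m) * (2 * CARD('n) * (norm (x - y))\<^sup>2)
      = (\<Sum>i\<in>UNIV. \<Sum>j\<in>UNIV. min_slope b (2 * m) * ((x - y) $ i - (x - y) $ j)\<^sup>2)"
    by (simp only: sum_sq_differences[OF assms(1), symmetric] sum_distrib_left)
  also have "\<dots> \<le> dissipation b x y"
    unfolding dissipation_def
  proof (intro sum_mono)
    fix i j
    have d: "\<bar>z $ i - z $ j\<bar> \<le> 2 * m" if "norm z \<le> m" for z :: "real ^ 'n"
      using component_le_norm_cart[of z i] component_le_norm_cart[of z j] that by linarith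
    have "(x - y) $ i - (x - y) $ j = (x $ i - x $ j) - (y $ i - y $ j)" by simp
    then show "min_slope b (2 * m) * ((x - y) $ i - (x - y) $ j)\<^sup>2 \<le> pair_diss b x y i j"
      unfolding pair_diss_def
      using increment_ge_slope[OF d[OF assms(2)] d[OF assms(3)]] by (simp only:)
  qed
  finally show ?thesis .
qed

text \<open>Since \<open>\<rho>\<close> is fixed, the differences of its coordinates are bounded and every pair term grows at least
  linearly.\<close>

lemma dissipation_coercive:
  "\<exists>c>0. \<exists>B. \<forall>x\<in>zero_sum. c * norm (x - \<rho>) - B \<le> dissipation b x \<rho>"
proof (intro exI conjI ballI)
  define r where "r = 2 * norm \<rho> + 1"
  have r: "1 \<le> r" unfolding r_def by simp
  show "0 < min_slope b r" using b_slope r by simp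
  fix x :: "real ^ 'n" assume x: "x \<in> zero_sum"
  have "min_slope b r * norm (x - \<rho>) - min_slope b r * (real CARD('n))\<^sup>2
      \<le> min_slope b r * (\<Sum>i\<in>UNIV. \<Sum>j\<in>UNIV. \<bar>(x - \<rho>) $ i - (x - \<rho>) $ j\<bar>)
        - min_slope b r * (real CARD('n))\<^sup>2"
    using norm_le_sum_abs_differences[OF zero_sum_diff[OF x skills]] \<open>0 < min_slope b r\<close> by simp
  also have "\<dots> = (\<Sum>i\<in>UNIV. \<Sum>j\<in>UNIV.
      min_slope b r * (\<bar>(x $ i - x $ j) - (\<rho> $ i - \<rho> $ j)\<bar> - 1))"
    by (simp add: sum_subtractf right_diff_distrib sum_distrib_left power2_eq_square algebra_simps)
  also have "\<dots> \<le> dissipation b x \<rho>"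
    unfolding dissipation_def pair_diss_def
  proof (intro sum_mono increment_ge_linear r)
    fix i j
    show "\<bar>\<rho> $ i - \<rho> $ j\<bar> \<le> r - 1"
      unfolding r_def using component_le_norm_cart[of \<rho> i] component_le_norm_cart[of \<rho> j]
      by linarith
  qed
  finally show "min_slope b r * norm (x - \<rho>) - min_slope b r * (real CARD('n))\<^sup>2
    \<le> dissipation b x \<rho>" .
qed

end

section \<open>The coupled processes and their filtration\<close>

locale elo_coupling = elo_model W \<rho> b L K S
  for W :: "'w measure" and \<rho> :: "real ^ 'n" and b :: "real \<Rightarrow> real" and L K :: real
    and S :: "'n \<Rightarrow> 'n \<Rightarrow> 'w \<Rightarrow> real" +
  fixes M :: "'a measure"
    and I J :: "nat \<Rightarrow> 'a \<Rightarrow> 'n" and Z :: "nat \<Rightarrow> 'a \<Rightarrow> real"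
    and X Y :: "nat \<Rightarrow> 'a \<Rightarrow> real ^ 'n"
  assumes coupling: "natural_coupling M W b K S I J Z X Y"
begin

lemma rounds: "elo_rounds M W S (\<lambda>\<omega>. (X 0 \<omega>, Y 0 \<omega>)) I J Z"
  using coupling unfolding natural_coupling_def by blast

lemma X_process: "elo_process M W b K S I J Z X" and Y_process: "elo_process M W b K S I J Z Y"
  using coupling unfolding natural_coupling_def by blast+

sublocale run: prob_space M
  using rounds unfolding elo_rounds_def by blast

lemma X_Suc: "\<omega> \<in> space M \<Longrightarrow> X (Suc t) \<omega> = elo_step b K (I t \<omega>) (J t \<omega>) (Z t \<omega>) (X t \<omega>)"
  and Y_Suc: "\<omega> \<in> space M \<Longrightarrow> Y (Suc t) \<omega> = elo_step b K (I t \<omega>) (J t \<omega>) (Z t \<omega>) (Y t \<omega>)"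
  using X_process Y_process unfolding elo_process_def by blast+

lemma X_zero_sum: "\<omega> \<in> space M \<Longrightarrow> X t \<omega> \<in> zero_sum"
  using X_process by (induction t) (auto simp: elo_process_def X_Suc elo_step_zero_sum)

lemma Y_zero_sum: "\<omega> \<in> space M \<Longrightarrow> Y t \<omega> \<in> zero_sum"
  using Y_process by (induction t) (auto simp: elo_process_def Y_Suc elo_step_zero_sum)

lemma distance_decseq:
  assumes "\<omega> \<in> space M"
  shows "decseq (\<lambda>t. norm (X t \<omega> - Y t \<omega>))"
  using assms by (intro decseq_SucI) (simp add: X_Suc Y_Suc elo_step_contracts_norm)

definition past :: "nat \<Rightarrow> 'a measure" where
  "past t = vimage_algebra (space M)
     (\<lambda>\<omega>. ((X 0 \<omega>, Y 0 \<omega>), \<lambda>s\<in>{..<t}. (I s \<omega>, J s \<omega>, Z s \<omega>)))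
     (borel \<Otimes>\<^sub>M (\<Pi>\<^sub>M s\<in>{..<t}. round_space))"

definition present :: "nat \<Rightarrow> 'a measure" where
  "present t = vimage_algebra (space M) (\<lambda>\<omega>. (I t \<omega>, J t \<omega>, Z t \<omega>)) round_space"

lemma space_past [simp]: "space (past t) = space M"
  and space_present [simp]: "space (present t) = space M"
  by (simp_all add: past_def present_def)

lemma indep_past_present: "run.indep_set (sets (past t)) (sets (present t))"
  using rounds unfolding elo_rounds_def past_def present_def by blast

lemma subalgebra_past: "subalgebra M (past t)" and subalgebra_present: "subalgebra M (present t)"
  using indep_past_present[of t] by (auto simp: subalgebra_def run.indep_sets2_eq)

lemma round_present:
  "I t \<in> present t \<rightarrow>\<^sub>M count_space UNIV" "J t \<in> present t \<rightarrow>\<^sub>M count_space UNIV"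
  "Z t \<in> borel_measurable (present t)"
proof -
  have [measurable]: "(\<lambda>\<omega>. (I t \<omega>, J t \<omega>, Z t \<omega>)) \<in> present t \<rightarrow>\<^sub>M round_space"
    unfolding present_def by (rule measurable_vimage_algebra1) (simp add: space_pair_measure)
  have "(\<lambda>\<omega>. fst (I t \<omega>, J t \<omega>, Z t \<omega>)) \<in> present t \<rightarrow>\<^sub>M count_space UNIV"
    "(\<lambda>\<omega>. fst (snd (I t \<omega>, J t \<omega>, Z t \<omega>))) \<in> present t \<rightarrow>\<^sub>M count_space UNIV"
    "(\<lambda>\<omega>. snd (snd (I t \<omega>, J t \<omega>, Z t \<omega>))) \<in> borel_measurable (present t)"
    by measurable
  then show "I t \<in> present t \<rightarrow>\<^sub>M count_space UNIV" "J t \<in> present t \<rightarrow>\<^sub>M count_space UNIV"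
    "Z t \<in> borel_measurable (present t)"
    by simp_all
qed

lemma round_measurable [measurable]:
  "I t \<in> M \<rightarrow>\<^sub>M count_space UNIV" "J t \<in> M \<rightarrow>\<^sub>M count_space UNIV" "Z t \<in> borel_measurable M"
  using round_present[of t] by (auto intro: measurable_from_subalg[OF subalgebra_present])

lemma initial_past: "X 0 \<in> borel_measurable (past t)" "Y 0 \<in> borel_measurable (past t)"
  and round_past: "s < t \<Longrightarrow> I s \<in> past t \<rightarrow>\<^sub>M count_space UNIV"
    "s < t \<Longrightarrow> J s \<in> past t \<rightarrow>\<^sub>M count_space UNIV"
    "s < t \<Longrightarrow> Z s \<in> borel_measurable (past t)"
proof -
  let ?h = "\<lambda>\<omega>. ((X 0 \<omega>, Y 0 \<omega>), \<lambda>s\<in>{..<t}. (I s \<omega>, J s \<omega>, Z s \<omega>))"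
  have h: "?h \<in> past t \<rightarrow>\<^sub>M borel \<Otimes>\<^sub>M (\<Pi>\<^sub>M s\<in>{..<t}. round_space)"
    unfolding past_def
    by (rule measurable_vimage_algebra1) (auto simp: space_pair_measure space_PiM)
  have "(\<lambda>\<omega>. fst (?h \<omega>)) \<in> past t \<rightarrow>\<^sub>M borel"
    using h by (rule measurable_compose) simp
  then have U: "(\<lambda>\<omega>. (X 0 \<omega>, Y 0 \<omega>)) \<in> past t \<rightarrow>\<^sub>M borel \<Otimes>\<^sub>M borel"
    by (simp add: borel_prod)
  show "X 0 \<in> borel_measurable (past t)" "Y 0 \<in> borel_measurable (past t)"
    using measurable_compose[OF U measurable_fst] measurable_compose[OF U measurable_snd] by simp_all
  assume s: "s < t"
  have r: "(\<lambda>\<omega>. snd (?h \<omega>) s) \<in> past t \<rightarrow>\<^sub>M round_space"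
    using s by (intro measurable_compose[OF h] measurable_compose[OF measurable_snd]
        measurable_component_singleton) auto
  then have [measurable]: "(\<lambda>\<omega>. (I s \<omega>, J s \<omega>, Z s \<omega>)) \<in> past t \<rightarrow>\<^sub>M round_space"
    using s by simp
  have "(\<lambda>\<omega>. fst (I s \<omega>, J s \<omega>, Z s \<omega>)) \<in> past t \<rightarrow>\<^sub>M count_space UNIV"
    "(\<lambda>\<omega>. fst (snd (I s \<omega>, J s \<omega>, Z s \<omega>))) \<in> past t \<rightarrow>\<^sub>M count_space UNIV"
    "(\<lambda>\<omega>. snd (snd (I s \<omega>, J s \<omega>, Z s \<omega>))) \<in> borel_measurable (past t)"
    by measurable
  then show "I s \<in> past t \<rightarrow>\<^sub>M count_space UNIV" "J s \<in> past t \<rightarrow>\<^sub>M count_space UNIV"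
    "Z s \<in> borel_measurable (past t)"
    by simp_all
qed

text \<open>The players form a finite set, so an update whose pair is random is measurable as soon as the update
  is measurable for each fixed pair.\<close>

lemma elo_step_measurable:
  fixes x :: "'c \<Rightarrow> real ^ 'n"
  assumes i: "i \<in> N \<rightarrow>\<^sub>M count_space UNIV" and j: "j \<in> N \<rightarrow>\<^sub>M count_space UNIV"
    and [measurable]: "s \<in> borel_measurable N" "x \<in> borel_measurable N"
  shows "(\<lambda>\<omega>. elo_step b K (i \<omega>) (j \<omega>) (s \<omega>) (x \<omega>)) \<in> borel_measurable N"
proof -
  have "(\<lambda>\<omega>. elo_step b K k l (s \<omega>) (x \<omega>)) \<in> borel_measurable N" for k l
  proof -
    have [measurable]: "(\<lambda>\<omega>. x \<omega> $ m) \<in> borel_measurable N" for m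
      by (intro measurable_compose[OF assms(4)] borel_measurable_continuous_onI continuous_intros)
    show ?thesis unfolding elo_step_def by measurable
  qed
  then have "(\<lambda>\<omega>. elo_step b K (i \<omega>) l (s \<omega>) (x \<omega>)) \<in> borel_measurable N" for l
    by (rule measurable_compose_countable[OF _ i])
  then show ?thesis
    by (rule measurable_compose_countable[OF _ j])
qed

lemma state_past_le: "s \<le> t \<Longrightarrow> X s \<in> borel_measurable (past t) \<and> Y s \<in> borel_measurable (past t)"
proof (induction s)
  case 0
  show ?case using initial_past by blast
next
  case (Suc s)
  then have IH: "X s \<in> borel_measurable (past t)" "Y s \<in> borel_measurable (past t)" and s: "s < t"
    by auto
  have "X (Suc s) \<in> borel_measurable (past t) \<longleftrightarrow>
      (\<lambda>\<omega>. elo_step b K (I s \<omega>) (J s \<omega>) (Z s \<omega>) (X s \<omega>)) \<in> borel_measurable (past t)"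
    by (rule measurable_cong) (simp add: X_Suc)
  moreover have "Y (Suc s) \<in> borel_measurable (past t) \<longleftrightarrow>
      (\<lambda>\<omega>. elo_step b K (I s \<omega>) (J s \<omega>) (Z s \<omega>) (Y s \<omega>)) \<in> borel_measurable (past t)"
    by (rule measurable_cong) (simp add: Y_Suc)
  ultimately show ?case
    using elo_step_measurable[OF round_past[OF s]] IH by blast
qed

lemma state_past [measurable]: "X t \<in> borel_measurable (past t)" "Y t \<in> borel_measurable (past t)"
  using state_past_le by blast+

section \<open>The law of a round\<close>

definition pair_prob :: real where
  "pair_prob = 1 / card {(i, j :: 'n). i \<noteq> j}"

lemma pair_prob_pos: "0 < pair_prob"
proof -
  obtain i j :: 'n where "i \<noteq> j"
    using players card_2_iff' ex_card[of 2 "UNIV :: 'n set"] by (metis UNIV_I)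
  then have "card {(i, j :: 'n). i \<noteq> j} > 0"
    by (auto simp: card_gt_0_iff)
  then show ?thesis by (simp add: pair_prob_def)
qed

lemma pair_measurable: "(\<lambda>\<omega>. (I t \<omega>, J t \<omega>)) \<in> M \<rightarrow>\<^sub>M count_space UNIV"
  using measurable_Pair[OF round_measurable(1,2)[of t]] by (simp add: pair_measure_countable)

lemma pair_law:
  "distr M (count_space UNIV) (\<lambda>\<omega>. (I t \<omega>, J t \<omega>)) = uniform_measure (count_space UNIV) {(i, j). i \<noteq> j}"
  using rounds unfolding elo_rounds_def by blast

lemma prob_pair:
  assumes "i \<noteq> j"
  shows "run.prob {\<omega> \<in> space M. I t \<omega> = i \<and> J t \<omega> = j} = pair_prob"
proof -
  have "run.prob {\<omega> \<in> space M. I t \<omega> = i \<and> J t \<omega> = j} =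
      measure (distr M (count_space UNIV) (\<lambda>\<omega>. (I t \<omega>, J t \<omega>))) {(i, j)}"
    using pair_measurable[of t] by (subst measure_distr) (auto intro!: arg_cong[where f = run.prob])
  also have "\<dots> = pair_prob"
    unfolding pair_law using assms
    by (subst measure_uniform_measure)
      (auto simp: pair_prob_def emeasure_count_space measure_count_space)
  finally show ?thesis .
qed

lemma expectation_pair_indicator:
  assumes "i \<noteq> j"
  shows "run.expectation (\<lambda>\<omega>. of_bool (I t \<omega> = i \<and> J t \<omega> = j)) = pair_prob"
proof -
  have "run.expectation (\<lambda>\<omega>. of_bool (I t \<omega> = i \<and> J t \<omega> = j))
      = run.expectation (indicator {\<omega> \<in> space M. I t \<omega> = i \<and> J t \<omega> = j})"
    by (intro Bochner_Integration.integral_cong) (auto simp: indicator_def)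
  also have "\<dots> = pair_prob"
    using prob_pair[OF assms, of t] by (simp add: Int_def conj_ac)
  finally show ?thesis .
qed

lemma AE_pair_distinct: "AE \<omega> in M. I t \<omega> \<noteq> J t \<omega>"
proof -
  have "AE z in distr M (count_space UNIV) (\<lambda>\<omega>. (I t \<omega>, J t \<omega>)). fst z \<noteq> snd z"
    unfolding pair_law by (rule AE_uniform_measureI) auto
  then show ?thesis
    by (subst (asm) AE_distr_iff[OF pair_measurable]) auto
qed

lemma prob_score_pair:
  assumes "i \<noteq> j" "A \<in> sets borel"
  shows "run.prob {\<omega> \<in> space M. Z t \<omega> \<in> A \<and> I t \<omega> = i \<and> J t \<omega> = j}
    = pair_prob * prob {w \<in> space W. S i j w \<in> A}"
proof -
  have "\<P>(\<omega> in M. Z t \<omega> \<in> A \<bar> I t \<omega> = i \<and> J t \<omega> = j) = \<P>(w in W. S i j w \<in> A)"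
    using rounds assms unfolding elo_rounds_def by blast
  then show ?thesis
    using prob_pair[OF assms(1), of t] pair_prob_pos
    unfolding cond_prob_def by (simp add: field_simps)
qed

text \<open>The model prescribes the conditional score through single probabilities; as an equality of measures
  this transfers the mean of \<open>S i j\<close> to the score.\<close>

lemma score_law:
  assumes ij: "i \<noteq> j"
  shows "distr (uniform_measure M {\<omega> \<in> space M. I t \<omega> = i \<and> J t \<omega> = j}) borel (Z t)
    = distr W borel (S i j)" (is "distr ?U _ _ = _")
proof -
  note [measurable] = score_measurable[OF ij]
  let ?E = "{\<omega> \<in> space M. I t \<omega> = i \<and> J t \<omega> = j}"
  have E: "emeasure M ?E \<noteq> 0" "emeasure M ?E \<noteq> \<infinity>"
    using prob_pair[OF ij, of t] pair_prob_pos
    by (auto simp: run.emeasure_eq_measure)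
  interpret U: prob_space ?U by (rule prob_space_uniform_measure[OF E])
  have E': "?E \<in> sets M" by measurable
  have Z: "Z t \<in> borel_measurable ?U" by simp
  have "measure (distr ?U borel (Z t)) A = measure (distr W borel (S i j)) A"
    if A: "A \<in> sets borel" for A
  proof -
    have ZA: "Z t -` A \<inter> space M \<in> sets M"
      using A by measurable
    have "measure (distr ?U borel (Z t)) A = measure ?U (Z t -` A \<inter> space M)"
      using A by (subst measure_distr[OF Z]) auto
    also have "\<dots> = run.prob (?E \<inter> (Z t -` A \<inter> space M)) / run.prob ?E"
      using measure_uniform_measure[OF E ZA] .
    also have "?E \<inter> (Z t -` A \<inter> space M) = {\<omega> \<in> space M. Z t \<omega> \<in> A \<and> I t \<omega> = i \<and> J t \<omega> = j}"
      by auto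
    also have "run.prob \<dots> / run.prob ?E = prob {w \<in> space W. S i j w \<in> A}"
      using prob_score_pair[OF ij A, of t] prob_pair[OF ij, of t] pair_prob_pos by simp
    also have "\<dots> = measure (distr W borel (S i j)) A"
      using A by (subst measure_distr) (auto intro!: arg_cong[where f = prob])
    finally show ?thesis .
  qed
  moreover have "finite_measure (distr ?U borel (Z t))" "finite_measure (distr W borel (S i j))"
    using U.prob_space_distr[OF Z] prob_space_distr[OF score_measurable[OF ij]]
    by (simp_all add: prob_space.finite_measure)
  ultimately show ?thesis
    by (intro measure_eqI) (auto simp: finite_measure.emeasure_eq_measure)
qed

lemma expectation_score_on_pair:
  assumes ij: "i \<noteq> j"
  shows "run.expectation (\<lambda>\<omega>. of_bool (I t \<omega> = i \<and> J t \<omega> = j) * Z t \<omega>)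
    = pair_prob * b (\<rho> $ i - \<rho> $ j)"
proof -
  let ?E = "{\<omega> \<in> space M. I t \<omega> = i \<and> J t \<omega> = j}"
  have E: "?E \<in> sets M" by measurable
  have em: "emeasure M ?E = ennreal pair_prob"
    using prob_pair[OF ij, of t] by (simp add: run.emeasure_eq_measure)
  have U: "uniform_measure M ?E = density M (\<lambda>\<omega>. ennreal (indicator ?E \<omega> / pair_prob))"
    unfolding uniform_measure_def em using pair_prob_pos
    by (intro arg_cong[where f = "density M"] ext)
      (simp add: divide_ennreal flip: ennreal_indicator)
  have "b (\<rho> $ i - \<rho> $ j) = integral\<^sup>L (distr W borel (S i j)) (\<lambda>z. z)"
    using score_mean[OF ij] score_measurable[OF ij] by (subst integral_distr) auto
  also have "\<dots> = integral\<^sup>L (uniform_measure M ?E) (Z t)"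
    unfolding score_law[OF ij, of t, symmetric] by (subst integral_distr) auto
  also have "\<dots> = run.expectation (\<lambda>\<omega>. (indicator ?E \<omega> / pair_prob) *\<^sub>R Z t \<omega>)"
    unfolding U using pair_prob_pos by (intro integral_density) auto
  also have "\<dots> = run.expectation (\<lambda>\<omega>. (of_bool (I t \<omega> = i \<and> J t \<omega> = j) * Z t \<omega>) / pair_prob)"
    by (intro Bochner_Integration.integral_cong) (auto simp: indicator_def)
  finally show ?thesis using pair_prob_pos by simp
qed

lemma AE_score_bounded: "AE \<omega> in M. \<bar>Z t \<omega>\<bar> \<le> 1"
proof -
  have "AE \<omega> in M. I t \<omega> = i \<and> J t \<omega> = j \<longrightarrow> \<bar>Z t \<omega>\<bar> \<le> 1" if ij: "i \<noteq> j" for i j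
  proof -
    have "{w \<in> space W. S i j w \<in> - {-1..1}} = {}"
      using score_range[OF ij] by auto
    moreover have "- {-1..1 :: real} \<in> sets borel" by simp
    ultimately have "run.prob {\<omega> \<in> space M. Z t \<omega> \<in> - {-1..1} \<and> I t \<omega> = i \<and> J t \<omega> = j} = 0"
      by (simp only: prob_score_pair[OF ij] measure_empty mult_zero_right)
    then have "AE \<omega> in M. \<not> (Z t \<omega> \<in> - {-1..1} \<and> I t \<omega> = i \<and> J t \<omega> = j)"
      by (subst (asm) run.prob_eq_0) auto
    then show ?thesis by eventually_elim auto
  qed
  then have "AE \<omega> in M. \<forall>i j. i \<noteq> j \<longrightarrow> I t \<omega> = i \<and> J t \<omega> = j \<longrightarrow> \<bar>Z t \<omega>\<bar> \<le> 1"
    unfolding AE_all_countable by auto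
  with AE_pair_distinct[of t] show ?thesis
    by eventually_elim auto
qed

section \<open>Averaging over the current round\<close>

lemma expectation_mult_past_present:
  fixes G H :: "'a \<Rightarrow> real"
  assumes G: "G \<in> borel_measurable (past t)" "AE \<omega> in M. \<bar>G \<omega>\<bar> \<le> B"
    and H: "H \<in> borel_measurable (present t)" "AE \<omega> in M. \<bar>H \<omega>\<bar> \<le> B'"
  shows "integrable M (\<lambda>\<omega>. G \<omega> * H \<omega>)"
    and "run.expectation (\<lambda>\<omega>. G \<omega> * H \<omega>) = run.expectation G * run.expectation H"
proof -
  have GM: "G \<in> borel_measurable M" and HM: "H \<in> borel_measurable M"
    using measurable_from_subalg[OF subalgebra_past G(1)]
      measurable_from_subalg[OF subalgebra_present H(1)] .
  have "integrable M G"
    using G(2) by (intro run.integrable_const_bound[of G B] GM) simp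
  moreover have "integrable M H"
    using H(2) by (intro run.integrable_const_bound[of H B'] HM) simp
  ultimately have int: "integrable M G" "integrable M H" .
  have sub: "{f -` A \<inter> space N | A. A \<in> sets borel} \<subseteq> sets N"
    if "f \<in> borel_measurable N" for f :: "'a \<Rightarrow> real" and N
    using that by (auto simp: measurable_def)
  have "run.indep_set (sigma_sets (space M) {G -` A \<inter> space M | A. A \<in> sets borel})
      (sigma_sets (space M) {H -` A \<inter> space M | A. A \<in> sets borel})"
  proof -
    have "sigma_sets (space M) {G -` A \<inter> space M | A. A \<in> sets borel} \<subseteq> sets (past t)"
      using sets.sigma_sets_subset[OF sub[OF G(1)]] by simp
    moreover have "sigma_sets (space M) {H -` A \<inter> space M | A. A \<in> sets borel} \<subseteq> sets (present t)"
      using sets.sigma_sets_subset[OF sub[OF H(1)]] by simp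
    ultimately show ?thesis
      using indep_past_present[of t] unfolding run.indep_sets2_eq by blast
  qed
  then have "run.indep_var borel G borel H"
    unfolding run.indep_var_eq using GM HM by blast
  then show "integrable M (\<lambda>\<omega>. G \<omega> * H \<omega>)"
    and "run.expectation (\<lambda>\<omega>. G \<omega> * H \<omega>) = run.expectation G * run.expectation H"
    using int by (auto intro: run.indep_var_integrable run.indep_var_lebesgue_integral)
qed

text \<open>The expectation of a product over the random pair is split according to the value of the pair; on
  each part the past and the present factor are independent. The past factor vanishes on the
  diagonal, so the mean of the present factor matters only for distinct players. The lemma is applied
  with \<open>h = 1\<close>, where \<open>c\<close> is the probability of a pair, and with \<open>h\<close> the noise of the score, where
  \<open>c = 0\<close>.\<close>

lemma expectation_over_pair:
  fixes F h :: "'n \<Rightarrow> 'n \<Rightarrow> 'a \<Rightarrow> real"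
  assumes F: "\<And>i j. F i j \<in> borel_measurable (past t)" "\<And>i j. \<exists>B. AE \<omega> in M. \<bar>F i j \<omega>\<bar> \<le> B"
    and diag: "\<And>i \<omega>. F i i \<omega> = 0"
    and h: "\<And>i j. h i j \<in> borel_measurable (present t)" "\<And>i j. \<exists>B. AE \<omega> in M. \<bar>h i j \<omega>\<bar> \<le> B"
    and mean: "\<And>i j. i \<noteq> j \<Longrightarrow>
      run.expectation (\<lambda>\<omega>. of_bool (I t \<omega> = i \<and> J t \<omega> = j) * h i j \<omega>) = c"
  shows "integrable M (\<lambda>\<omega>. F (I t \<omega>) (J t \<omega>) \<omega> * h (I t \<omega>) (J t \<omega>) \<omega>)"
    and "run.expectation (\<lambda>\<omega>. F (I t \<omega>) (J t \<omega>) \<omega> * h (I t \<omega>) (J t \<omega>) \<omega>)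
      = c * run.expectation (\<lambda>\<omega>. \<Sum>i\<in>UNIV. \<Sum>j\<in>UNIV. F i j \<omega>)"
proof -
  let ?H = "\<lambda>i j \<omega>. of_bool (I t \<omega> = i \<and> J t \<omega> = j) * h i j \<omega>"
  have pair_sum: "F (I t \<omega>) (J t \<omega>) \<omega> * h (I t \<omega>) (J t \<omega>) \<omega>
      = (\<Sum>i\<in>UNIV. \<Sum>j\<in>UNIV. F i j \<omega> * ?H i j \<omega>)" for \<omega>
  proof -
    have "(\<Sum>i\<in>UNIV. \<Sum>j\<in>UNIV. F i j \<omega> * ?H i j \<omega>)
        = (\<Sum>i\<in>UNIV. \<Sum>j\<in>UNIV. if j = J t \<omega> then if i = I t \<omega> then F i j \<omega> * h i j \<omega> else 0 else 0)"
      by (intro sum.cong) auto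
    then show ?thesis by simp
  qed
  have H: "?H i j \<in> borel_measurable (present t)" for i j
  proof -
    note [measurable] = round_present[of t] h(1)
    show ?thesis by measurable
  qed
  have int: "integrable M (\<lambda>\<omega>. F i j \<omega> * ?H i j \<omega>)"
    and E: "run.expectation (\<lambda>\<omega>. F i j \<omega> * ?H i j \<omega>) = c * run.expectation (F i j)" for i j
  proof -
    obtain B B' where B: "AE \<omega> in M. \<bar>F i j \<omega>\<bar> \<le> B" and B': "AE \<omega> in M. \<bar>h i j \<omega>\<bar> \<le> B'"
      using F(2) h(2) by meson
    from B' have B': "AE \<omega> in M. \<bar>?H i j \<omega>\<bar> \<le> B'"
      by eventually_elim auto
    note prod = expectation_mult_past_present[OF F(1) B H B']
    show "integrable M (\<lambda>\<omega>. F i j \<omega> * ?H i j \<omega>)" by (rule prod)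
    show "run.expectation (\<lambda>\<omega>. F i j \<omega> * ?H i j \<omega>) = c * run.expectation (F i j)"
    proof (cases "i = j")
      case True
      then have "F i j = (\<lambda>_. 0)" using diag by auto
      then show ?thesis by simp
    next
      case False
      then show ?thesis unfolding prod(2) mean[OF False] by simp
    qed
  qed
  have intF: "integrable M (F i j)" for i j
  proof -
    obtain B where "AE \<omega> in M. \<bar>F i j \<omega>\<bar> \<le> B" using F(2) by meson
    then show ?thesis
      by (auto intro!: run.integrable_const_bound measurable_from_subalg[OF subalgebra_past F(1)])
  qed
  show "integrable M (\<lambda>\<omega>. F (I t \<omega>) (J t \<omega>) \<omega> * h (I t \<omega>) (J t \<omega>) \<omega>)"
    unfolding pair_sum by (intro Bochner_Integration.integrable_sum int)
  show "run.expectation (\<lambda>\<omega>. F (I t \<omega>) (J t \<omega>) \<omega> * h (I t \<omega>) (J t \<omega>) \<omega>)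
      = c * run.expectation (\<lambda>\<omega>. \<Sum>i\<in>UNIV. \<Sum>j\<in>UNIV. F i j \<omega>)"
    unfolding pair_sum
    by (simp add: Bochner_Integration.integral_sum Bochner_Integration.integrable_sum int intF E
        sum_distrib_left)
qed

text \<open>The indicator that localises to initial states in a ball, as a real weight under expectations.\<close>

definition start_in :: "real \<Rightarrow> 'a \<Rightarrow> real" where
  "start_in n \<omega> = of_bool (norm (X 0 \<omega>) \<le> n \<and> norm (Y 0 \<omega>) \<le> n)"

lemma start_in_nonneg: "0 \<le> start_in n \<omega>"
  by (simp add: start_in_def)

lemma AE_norm_state_le:
  "AE \<omega> in M. norm (X t \<omega>) \<le> norm (X 0 \<omega>) + t * (4 * K) \<and> norm (Y t \<omega>) \<le> norm (Y 0 \<omega>) + t * (4 * K)"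
proof (induction t)
  case (Suc t)
  with AE_score_bounded[of t] AE_space show ?case
  proof eventually_elim
    case (elim \<omega>)
    then show ?case
      using norm_elo_step_le[of "Z t \<omega>" "I t \<omega>" "J t \<omega>" "X t \<omega>"]
        norm_elo_step_le[of "Z t \<omega>" "I t \<omega>" "J t \<omega>" "Y t \<omega>"]
      by (simp add: X_Suc Y_Suc algebra_simps)
  qed
qed simp

text \<open>A continuous function is bounded on balls, and ratings that start in a ball and change by at most
  \<open>4 * K\<close> per round are still in a ball at time \<open>t\<close>.\<close>

lemma localised_observable:
  fixes f :: "(real ^ 'n) \<times> (real ^ 'n) \<Rightarrow> real"
  assumes f: "continuous_on UNIV f"
  shows "(\<lambda>\<omega>. start_in n \<omega> * f (X t \<omega>, Y t \<omega>)) \<in> borel_measurable (past t)"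
    and "\<exists>B. AE \<omega> in M. \<bar>start_in n \<omega> * f (X t \<omega>, Y t \<omega>)\<bar> \<le> B"
    and "integrable M (\<lambda>\<omega>. start_in n \<omega> * f (X t \<omega>, Y t \<omega>))"
proof -
  have [measurable]: "f \<in> borel_measurable borel"
    using f by (rule borel_measurable_continuous_onI)
  note [measurable] = initial_past[of t]
  show m: "(\<lambda>\<omega>. start_in n \<omega> * f (X t \<omega>, Y t \<omega>)) \<in> borel_measurable (past t)"
    unfolding start_in_def by measurable
  define r where "r = n + t * (4 * K)"
  have "bounded (f ` (cball 0 r \<times> cball 0 r))"
    by (intro compact_imp_bounded compact_continuous_image continuous_on_subset[OF f]
        compact_Times compact_cball) auto
  then obtain B where B: "\<And>z. z \<in> cball 0 r \<times> cball 0 r \<Longrightarrow> \<bar>f z\<bar> \<le> B"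
    unfolding bounded_iff by auto
  from AE_norm_state_le[of t] have "AE \<omega> in M. \<bar>start_in n \<omega> * f (X t \<omega>, Y t \<omega>)\<bar> \<le> max B 0"
  proof eventually_elim
    case (elim \<omega>)
    show ?case
    proof (cases "norm (X 0 \<omega>) \<le> n \<and> norm (Y 0 \<omega>) \<le> n")
      case True
      then have "\<bar>f (X t \<omega>, Y t \<omega>)\<bar> \<le> B"
        using elim by (intro B) (auto simp: r_def)
      then show ?thesis using True by (simp add: start_in_def)
    qed (auto simp: start_in_def)
  qed
  then show "\<exists>B. AE \<omega> in M. \<bar>start_in n \<omega> * f (X t \<omega>, Y t \<omega>)\<bar> \<le> B"
    and "integrable M (\<lambda>\<omega>. start_in n \<omega> * f (X t \<omega>, Y t \<omega>))"
    by (auto intro!: run.integrable_const_bound measurable_from_subalg[OF subalgebra_past m])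
qed

lemma continuous_on_pair_diss [continuous_intros]:
  fixes g k :: "'c::topological_space \<Rightarrow> real ^ 'n"
  assumes "continuous_on A g" "continuous_on A k"
  shows "continuous_on A (\<lambda>z. pair_diss b (g z) (k z) i j)"
  unfolding pair_diss_def
  by (intro continuous_intros assms continuous_on_compose2[OF continuous_on_b]) auto

lemma continuous_on_dissipation [continuous_intros]:
  fixes g k :: "'c::topological_space \<Rightarrow> real ^ 'n"
  assumes "continuous_on A g" "continuous_on A k"
  shows "continuous_on A (\<lambda>z. dissipation b (g z) (k z))"
  unfolding dissipation_def by (intro continuous_intros assms)

text \<open>The reference state \<open>k\<close> is either the second process or the constant \<open>\<rho>\<close>.\<close>

lemma expectation_pair_diss:
  fixes k :: "(real ^ 'n) \<times> (real ^ 'n) \<Rightarrow> real ^ 'n" and n :: real and t :: nat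
  assumes k: "continuous_on UNIV k"
  defines "P \<equiv> \<lambda>\<omega>. start_in n \<omega> * pair_diss b (X t \<omega>) (k (X t \<omega>, Y t \<omega>)) (I t \<omega>) (J t \<omega>)"
  shows "integrable M P"
    and "run.expectation P
      = pair_prob * run.expectation (\<lambda>\<omega>. start_in n \<omega> * dissipation b (X t \<omega>) (k (X t \<omega>, Y t \<omega>)))"
proof -
  let ?F = "\<lambda>i j \<omega>. start_in n \<omega> * pair_diss b (X t \<omega>) (k (X t \<omega>, Y t \<omega>)) i j"
  have c: "continuous_on UNIV (\<lambda>z. pair_diss b (fst z) (k z) i j)" for i j
    by (intro continuous_intros k)
  have mean: "run.expectation (\<lambda>\<omega>. of_bool (I t \<omega> = i \<and> J t \<omega> = j) * (1::real)) = pair_prob"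
    if "i \<noteq> j" for i j
    using expectation_pair_indicator[OF that, of t] by simp
  note res = expectation_over_pair[of ?F t "\<lambda>_ _ _. 1" pair_prob,
      OF localised_observable(1)[OF c, of n t, simplified]
      localised_observable(2)[OF c, of n t, simplified] _ _ _ mean]
  show "integrable M P"
    unfolding P_def using res(1) by (force simp: pair_diss_def)
  show "run.expectation P
      = pair_prob * run.expectation (\<lambda>\<omega>. start_in n \<omega> * dissipation b (X t \<omega>) (k (X t \<omega>, Y t \<omega>)))"
    unfolding P_def dissipation_def sum_distrib_left using res(2) by (force simp: pair_diss_def)
qed

lemma expectation_score_noise:
  fixes n :: real and t :: nat
  defines "R \<equiv> \<lambda>\<omega>. start_in n \<omega> *
    ((Z t \<omega> - b (\<rho> $ I t \<omega> - \<rho> $ J t \<omega>)) *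
     ((X t \<omega> $ I t \<omega> - X t \<omega> $ J t \<omega>) - (\<rho> $ I t \<omega> - \<rho> $ J t \<omega>)))"
  shows "integrable M R" and "run.expectation R = 0"
proof -
  let ?F = "\<lambda>i j \<omega>. start_in n \<omega> * ((X t \<omega> $ i - X t \<omega> $ j) - (\<rho> $ i - \<rho> $ j))"
  let ?h = "\<lambda>i j \<omega>. Z t \<omega> - b (\<rho> $ i - \<rho> $ j)"
  have c: "continuous_on UNIV
      (\<lambda>z :: (real ^ 'n) \<times> (real ^ 'n). (fst z $ i - fst z $ j) - (\<rho> $ i - \<rho> $ j))" for i j
    by (intro continuous_intros)
  have h: "?h i j \<in> borel_measurable (present t)" for i j
    using round_present(3)[of t] by simp
  have hB: "\<exists>B. AE \<omega> in M. \<bar>?h i j \<omega>\<bar> \<le> B" for i j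
  proof
    from AE_score_bounded[of t] show "AE \<omega> in M. \<bar>?h i j \<omega>\<bar> \<le> 2"
      by eventually_elim (use b_bounded[of "\<rho> $ i - \<rho> $ j"] in linarith)
  qed
  have mean: "run.expectation (\<lambda>\<omega>. of_bool (I t \<omega> = i \<and> J t \<omega> = j) * ?h i j \<omega>) = 0"
    if ij: "i \<noteq> j" for i j
  proof -
    let ?e = "\<lambda>\<omega>. of_bool (I t \<omega> = i \<and> J t \<omega> = j) :: real"
    have iZ: "integrable M (\<lambda>\<omega>. ?e \<omega> * Z t \<omega>)"
    proof (rule run.integrable_const_bound[where B = 1])
      from AE_score_bounded[of t] show "AE \<omega> in M. norm (?e \<omega> * Z t \<omega>) \<le> 1"
        by eventually_elim auto
    qed measurable
    have ie: "integrable M ?e"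
      by (rule run.integrable_const_bound[where B = 1]) auto
    show ?thesis
      using iZ ie expectation_score_on_pair[OF ij, of t] expectation_pair_indicator[OF ij, of t]
      by (simp add: right_diff_distrib)
  qed
  note res = expectation_over_pair[of ?F t ?h 0,
      OF localised_observable(1)[OF c, of n t, simplified]
      localised_observable(2)[OF c, of n t, simplified] _ h hB mean]
  have R: "R = (\<lambda>\<omega>. ?F (I t \<omega>) (J t \<omega>) \<omega> * ?h (I t \<omega>) (J t \<omega>) \<omega>)"
    unfolding R_def by (simp add: mult_ac)
  show "integrable M R" "run.expectation R = 0"
    unfolding R using res by simp_all
qed

section \<open>Vanishing dissipation of the coupled processes\<close>

text \<open>The localised expected squared distance \<open>D t\<close> is nonnegative and loses at least a constant
  times the expected dissipation in each round, so the losses are summable.\<close>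

lemma AE_coupled_dissipation_tendsto_0:
  "AE \<omega> in M. (\<lambda>t. start_in n \<omega> * dissipation b (X t \<omega>) (Y t \<omega>)) \<longlonglongrightarrow> 0"
proof -
  define D where "D t = run.expectation (\<lambda>\<omega>. start_in n \<omega> * (norm (X t \<omega> - Y t \<omega>))\<^sup>2)" for t
  define E where "E t = run.expectation (\<lambda>\<omega>. start_in n \<omega> * dissipation b (X t \<omega>) (Y t \<omega>))" for t
  define c where "c = 2 * K * (1 - K * L)"
  have c: "c > 0" unfolding c_def using K_pos KL by simp
  have intD: "integrable M (\<lambda>\<omega>. start_in n \<omega> * (norm (X t \<omega> - Y t \<omega>))\<^sup>2)" for t
    using localised_observable(3)[of "\<lambda>z. (norm (fst z - snd z))\<^sup>2" n t]
    by (simp add: continuous_intros)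
  have intE: "integrable M (\<lambda>\<omega>. start_in n \<omega> * dissipation b (X t \<omega>) (Y t \<omega>))" for t
    using localised_observable(3)[of "\<lambda>z. dissipation b (fst z) (snd z)" n t]
    by (simp add: continuous_intros)
  note pd = expectation_pair_diss[OF continuous_on_snd[OF continuous_on_id], of n, unfolded snd_conv]
  have step: "(c * pair_prob) * E t \<le> D t - D (Suc t)" for t
  proof -
    let ?P = "\<lambda>\<omega>. start_in n \<omega> * pair_diss b (X t \<omega>) (Y t \<omega>) (I t \<omega>) (J t \<omega>)"
    have "D (Suc t) \<le> run.expectation (\<lambda>\<omega>. start_in n \<omega> * (norm (X t \<omega> - Y t \<omega>))\<^sup>2 - c * ?P \<omega>)"
      unfolding D_def
    proof (rule integral_mono[OF intD])
      show "integrable M (\<lambda>\<omega>. start_in n \<omega> * (norm (X t \<omega> - Y t \<omega>))\<^sup>2 - c * ?P \<omega>)"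
        by (intro Bochner_Integration.integrable_diff intD integrable_mult_right pd(1))
      fix \<omega> assume "\<omega> \<in> space M"
      then show "start_in n \<omega> * (norm (X (Suc t) \<omega> - Y (Suc t) \<omega>))\<^sup>2
          \<le> start_in n \<omega> * (norm (X t \<omega> - Y t \<omega>))\<^sup>2 - c * ?P \<omega>"
        using mult_left_mono[OF elo_step_contracts start_in_nonneg[of n \<omega>],
            of "I t \<omega>" "J t \<omega>" "Z t \<omega>" "X t \<omega>" "Y t \<omega>"]
        by (simp add: X_Suc Y_Suc c_def algebra_simps)
    qed
    also have "\<dots> = D t - c * (pair_prob * E t)"
      using intD pd(1)[of t] pd(2)[of t] unfolding D_def E_def by simp
    finally show ?thesis by (simp add: mult.assoc)
  qed
  have "(\<Sum>t<T. E t) \<le> D 0 / (c * pair_prob)" for T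
  proof -
    have "(c * pair_prob) * (\<Sum>t<T. E t) \<le> (\<Sum>t<T. D t - D (Suc t))"
      unfolding sum_distrib_left by (intro sum_mono step)
    also have "\<dots> = D 0 - D T"
      by (rule sum_lessThan_telescope')
    also have "\<dots> \<le> D 0"
      unfolding D_def by (simp add: start_in_nonneg)
    finally show ?thesis
      using c pair_prob_pos by (simp add: pos_le_divide_eq mult.commute)
  qed
  then show ?thesis
    by (intro AE_tendsto_0_if_summable_expectations intE)
      (auto simp: E_def start_in_nonneg dissipation_nonneg)
qed

section \<open>Recurrence\<close>

text \<open>The localised expected squared distance \<open>V t\<close> to the skills gains at most \<open>8 * K\<^sup>2\<close> per round and
  loses a multiple of the expected dissipation. As \<open>V\<close> stays nonnegative, the losses up to time
  \<open>T\<close> are at most linear in \<open>T\<close>.\<close>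

lemma AE_dissipation_not_at_top:
  "AE \<omega> in M. \<not> filterlim (\<lambda>t. start_in n \<omega> * dissipation b (X t \<omega>) \<rho>) at_top sequentially"
proof -
  define V where "V t = run.expectation (\<lambda>\<omega>. start_in n \<omega> * (norm (X t \<omega> - \<rho>))\<^sup>2)" for t
  define E where "E t = run.expectation (\<lambda>\<omega>. start_in n \<omega> * dissipation b (X t \<omega>) \<rho>)" for t
  define c where "c = 2 * K * pair_prob"
  have c: "c > 0" unfolding c_def using K_pos pair_prob_pos by simp
  have intV: "integrable M (\<lambda>\<omega>. start_in n \<omega> * (norm (X t \<omega> - \<rho>))\<^sup>2)" for t
    using localised_observable(3)[of "\<lambda>z. (norm (fst z - \<rho>))\<^sup>2" n t]
    by (simp add: continuous_intros)
  have intE: "integrable M (\<lambda>\<omega>. start_in n \<omega> * dissipation b (X t \<omega>) \<rho>)" for t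
    using localised_observable(3)[of "\<lambda>z. dissipation b (fst z) \<rho>" n t]
    by (simp add: continuous_intros)
  have V_nonneg: "0 \<le> V t" for t
    unfolding V_def by (simp add: start_in_nonneg)
  note pd = expectation_pair_diss[OF continuous_on_const[of UNIV \<rho>], of n]
  note noise = expectation_score_noise[of n]
  have step: "c * E t \<le> V t - V (Suc t) + 8 * K\<^sup>2" for t
  proof -
    let ?P = "\<lambda>\<omega>. start_in n \<omega> * pair_diss b (X t \<omega>) \<rho> (I t \<omega>) (J t \<omega>)"
    let ?R = "\<lambda>\<omega>. start_in n \<omega> * ((Z t \<omega> - b (\<rho> $ I t \<omega> - \<rho> $ J t \<omega>)) *
       ((X t \<omega> $ I t \<omega> - X t \<omega> $ J t \<omega>) - (\<rho> $ I t \<omega> - \<rho> $ J t \<omega>)))"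
    let ?Q = "\<lambda>\<omega>. start_in n \<omega> * (norm (X t \<omega> - \<rho>))\<^sup>2 - 2 * K * ?P \<omega> + 2 * K * ?R \<omega> + 8 * K\<^sup>2"
    have "V (Suc t) \<le> run.expectation ?Q"
      unfolding V_def
    proof (rule integral_mono_AE[OF intV])
      show "integrable M ?Q"
        by (intro Bochner_Integration.integrable_add Bochner_Integration.integrable_diff intV
            integrable_mult_right pd(1) noise(1)) simp
      from AE_score_bounded[of t] AE_space
      show "AE \<omega> in M. start_in n \<omega> * (norm (X (Suc t) \<omega> - \<rho>))\<^sup>2 \<le> ?Q \<omega>"
      proof eventually_elim
        case (elim \<omega>)
        have "start_in n \<omega> * (norm (X (Suc t) \<omega> - \<rho>))\<^sup>2
            \<le> start_in n \<omega> * (norm (X t \<omega> - \<rho>))\<^sup>2 - 2 * K * ?P \<omega> + 2 * K * ?R \<omega>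
              + start_in n \<omega> * (8 * K\<^sup>2)"
          using mult_left_mono[OF elo_step_drift[OF elim(1)] start_in_nonneg[of n \<omega>],
              of "I t \<omega>" "J t \<omega>" "X t \<omega>"] elim(2)
          by (simp add: X_Suc algebra_simps)
        moreover have "start_in n \<omega> * (8 * K\<^sup>2) \<le> 8 * K\<^sup>2"
          by (simp add: start_in_def)
        ultimately show ?case by linarith
      qed
    qed
    also have "\<dots> = V t - c * E t + 8 * K\<^sup>2"
      using intV pd(1)[of t] pd(2)[of t] noise(1)[of t] noise(2)[of t]
      unfolding V_def E_def c_def by (simp add: run.prob_space)
    finally show ?thesis by simp
  qed
  have bound: "(\<Sum>t<Suc T. E t) \<le> (V 0 + 8 * K\<^sup>2) / c * Suc T" for T
  proof -
    have "c * (\<Sum>t<Suc T. E t) \<le> (\<Sum>t<Suc T. V t - V (Suc t) + 8 * K\<^sup>2)"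
      unfolding sum_distrib_left by (intro sum_mono step)
    also have "\<dots> = V 0 - V (Suc T) + Suc T * (8 * K\<^sup>2)"
      by (simp only: sum.distrib sum_lessThan_telescope' sum_constant card_lessThan)
    also have "\<dots> \<le> 1 * V 0 + Suc T * (8 * K\<^sup>2)"
      using V_nonneg by simp
    also have "\<dots> \<le> Suc T * V 0 + Suc T * (8 * K\<^sup>2)"
      by (intro add_mono mult_right_mono V_nonneg) auto
    finally show ?thesis
      using c by (simp add: field_simps)
  qed
  show ?thesis
    by (rule AE_not_at_top_if_linear_expectations[OF intE _ bound[unfolded E_def]])
      (simp add: start_in_nonneg dissipation_nonneg)
qed

section \<open>Convergence of the coupled processes\<close>

text \<open>The distance decreases to some \<open>\<delta>\<close>. If \<open>\<delta>\<close> were positive, then at each of the infinitely many times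
  when the dissipation of \<open>X\<close> and \<open>\<rho>\<close> is below \<open>m\<close>, both states lie in a fixed ball and are at least
  \<open>\<delta>\<close> apart, which bounds their mutual dissipation away from \<open>0\<close>.\<close>

lemma distance_tendsto_0_if_recurrent:
  assumes \<omega>: "\<omega> \<in> space M"
    and diss: "(\<lambda>t. dissipation b (X t \<omega>) (Y t \<omega>)) \<longlonglongrightarrow> 0"
    and recurrent: "\<not> filterlim (\<lambda>t. dissipation b (X t \<omega>) \<rho>) at_top sequentially"
  shows "(\<lambda>t. norm (X t \<omega> - Y t \<omega>)) \<longlonglongrightarrow> 0"
proof -
  let ?d = "\<lambda>t. norm (X t \<omega> - Y t \<omega>)"
  note dec = distance_decseq[OF \<omega>]
  obtain \<delta> where lim: "?d \<longlonglongrightarrow> \<delta>" and ge: "\<And>t. \<delta> \<le> ?d t"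
    using decseq_convergent[OF dec, of 0] by auto
  have "0 \<le> \<delta>" using lim by (rule LIMSEQ_le_const) auto
  have "\<delta> = 0"
  proof (rule ccontr)
    assume "\<delta> \<noteq> 0"
    with \<open>0 \<le> \<delta>\<close> have \<delta>: "\<delta> > 0" by simp
    obtain m where m: "\<exists>\<^sub>F t in sequentially. dissipation b (X t \<omega>) \<rho> < m"
      using recurrent unfolding filterlim_at_top by (auto simp: not_eventually not_le)
    obtain c B where c: "c > 0"
      and coercive: "\<And>x. x \<in> zero_sum \<Longrightarrow> c * norm (x - \<rho>) - B \<le> dissipation b x \<rho>"
      using dissipation_coercive by auto
    \<comment> \<open>The ball: coercivity bounds \<open>X t - \<rho>\<close>, and \<open>Y t\<close> is within the initial distance of \<open>X t\<close>;
      the maximum with \<open>1\<close> only keeps the radius positive.\<close>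
    define r where "r = max 1 ((m + B) / c + norm \<rho> + ?d 0)"
    define \<eta> where "\<eta> = min_slope b (2 * r) * (2 * CARD('n) * \<delta>\<^sup>2)"
    have slope: "min_slope b (2 * r) > 0"
      using b_slope[of "2 * r"] by (simp add: r_def)
    then have \<eta>: "\<eta> > 0" unfolding \<eta>_def using \<delta> by simp
    have large: "\<eta> \<le> dissipation b (X t \<omega>) (Y t \<omega>)" if "dissipation b (X t \<omega>) \<rho> < m" for t
    proof -
      have "c * norm (X t \<omega> - \<rho>) \<le> m + B"
        using coercive[OF X_zero_sum[OF \<omega>, of t]] that by linarith
      then have "norm (X t \<omega> - \<rho>) \<le> (m + B) / c"
        using c by (simp add: field_simps)
      then have nX: "norm (X t \<omega>) \<le> (m + B) / c + norm \<rho>"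
        using norm_triangle_sub[of "X t \<omega>" \<rho>] by linarith
      have "?d t \<le> ?d 0" using dec by (simp add: decseq_def)
      then have nY: "norm (Y t \<omega>) \<le> (m + B) / c + norm \<rho> + ?d 0"
        using nX norm_triangle_sub[of "Y t \<omega>" "X t \<omega>"] by (simp add: norm_minus_commute)
      have "\<delta>\<^sup>2 \<le> (?d t)\<^sup>2" using ge \<delta> by (intro power_mono) auto
      then have "\<eta> \<le> min_slope b (2 * r) * (2 * CARD('n) * (?d t)\<^sup>2)"
        unfolding \<eta>_def using slope by (intro mult_left_mono) auto
      also have "\<dots> \<le> dissipation b (X t \<omega>) (Y t \<omega>)"
      proof (intro dissipation_ge_norm_sq zero_sum_diff X_zero_sum Y_zero_sum \<omega>)
        have "(m + B) / c + norm \<rho> + ?d 0 \<le> r" by (simp add: r_def)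
        with nX nY show "norm (X t \<omega>) \<le> r" "norm (Y t \<omega>) \<le> r"
          using norm_ge_zero[of "X 0 \<omega> - Y 0 \<omega>"] by linarith+
      qed
      finally show ?thesis .
    qed
    have "\<forall>\<^sub>F t in sequentially. dissipation b (X t \<omega>) (Y t \<omega>) < \<eta>"
      using order_tendstoD(2)[OF diss \<eta>] .
    from frequently_ex[OF frequently_eventually_frequently[OF m this]]
    show False using large by fastforce
  qed
  with lim show ?thesis by simp
qed

lemma AE_distance_tendsto_0: "AE \<omega> in M. (\<lambda>t. norm (X t \<omega> - Y t \<omega>)) \<longlonglongrightarrow> 0"
proof -
  have "AE \<omega> in M. \<forall>n::nat. (\<lambda>t. start_in n \<omega> * dissipation b (X t \<omega>) (Y t \<omega>)) \<longlonglongrightarrow> 0"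
    unfolding AE_all_countable using AE_coupled_dissipation_tendsto_0 by blast
  moreover have "AE \<omega> in M. \<forall>n::nat.
      \<not> filterlim (\<lambda>t. start_in n \<omega> * dissipation b (X t \<omega>) \<rho>) at_top sequentially"
    unfolding AE_all_countable using AE_dissipation_not_at_top by blast
  ultimately show ?thesis
    using AE_space
  proof eventually_elim
    case (elim \<omega>)
    obtain n :: nat where "max (norm (X 0 \<omega>)) (norm (Y 0 \<omega>)) \<le> n"
      using real_arch_simple by blast
    then have "start_in n \<omega> = 1" by (simp add: start_in_def)
    with elim(1)[rule_format, of n] elim(2)[rule_format, of n] elim(3) show ?case
      by (intro distance_tendsto_0_if_recurrent) auto
  qed
qed

end

theorem theorem12:
  fixes M :: "'a measure" and W :: "'w measure"
    and \<rho> :: "real ^ 'n"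
    and b :: "real \<Rightarrow> real" and L K :: real
    and S :: "'n \<Rightarrow> 'n \<Rightarrow> 'w \<Rightarrow> real"
    and I J :: "nat \<Rightarrow> 'a \<Rightarrow> 'n" and Z :: "nat \<Rightarrow> 'a \<Rightarrow> real"
    and X Y :: "nat \<Rightarrow> 'a \<Rightarrow> real ^ 'n"
  assumes "elo_model W \<rho> b L K S"
    and "natural_coupling M W b K S I J Z X Y"
  shows "(AE \<omega> in M. decseq (\<lambda>t. norm (X t \<omega> - Y t \<omega>))) \<and>
         (AE \<omega> in M. (\<lambda>t. norm (X t \<omega> - Y t \<omega>)) \<longlonglongrightarrow> 0)"
proof -
  interpret elo_coupling W \<rho> b L K S M I J Z X Y
    using assms unfolding elo_coupling_def elo_coupling_axioms_def by blast
  show ?thesis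
    using distance_decseq AE_distance_tendsto_0 by (auto intro: AE_I2)
qed

end
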